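(* Let $\mathcal H$ be a real Hilbert space, $T_\Gamma:\mathcal H\to\mathcal H$ and $T_{\Gamma_k}:\mathcal H\to\mathcal H$ ($k\in\mathbb N$) non-expansive operators with $\mathrm{fix}\,T_\Gamma\neq\emptyset$, $\varepsilon_k\in\mathcal H$, and let $(z_k)_{k\in\mathbb N}$ be generated from $z_0\in\mathcal H$ by $z_{k+1}=z_k+\lambda_k(T_{\Gamma_k}z_k+\varepsilon_k-z_k)$. For $\rho\ge0$ let $\Delta_{k,\rho}=\sup_{\|z\|\le\rho}\|T_{\Gamma_k}z-T_\Gamma z\|$. (i) Suppose that $\lambda_k\in(0,1)$ with $\underline\tau=\inf_k\lambda_k(1-\lambda_k)>0$, that $\sum_k(k+1)\|\varepsilon_k\|<+\infty$, and that $\sum_k(k+1)\Delta_{k,\rho}<+\infty$ for all $\rho\in[0,+\infty)$. Then $C_1<+\infty$ and for all $k\in\mathbb N$ $$\|e_k\|\le\sqrt{\frac{d_0^2+C_1}{\underline\tau(k+1)}} .$$ (ii) Suppose that $\lambda_k\in(0,1]$, $\sum_k\lambda_k\|\varepsilon_k\|<+\infty$, and $\sum_k\lambda_k\Delta_{k,\rho}<+\infty$ for all $\rho\in[0,+\infty)$. Then $C_2<+\infty$ and for all $k\in\mathbb N$ $$\|\bar e_k\|\le\frac{2(d_0+C_2)}{\Lambda_k}.$$ In particular, if $\inf_k\lambda_k>0$, then $\|\bar e_k\|=O(1/k)$.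
   Context: $\mathrm{fix}\,T=\{z:z=Tz\}$. $\pi_k=(T_{\Gamma_k}-T_\Gamma)z_k+\varepsilon_k$; $e_k=(z_k-z_{k+1})/\lambda_k+\pi_k=(\mathrm{Id}-T_\Gamma)z_k$; $\Lambda_k=\sum_{j=0}^k\lambda_j$; $\bar e_k=\frac1{\Lambda_k}\sum_{j=0}^k\lambda_je_j$; $d_0=\inf_{z\in\mathrm{fix}\,T_\Gamma}\|z_0-z\|$, attained at $z^\star\in\mathrm{fix}\,T_\Gamma$; $\tau_k=\lambda_k(1-\lambda_k)$, $\overline\tau=\sup_k\tau_k$; $\nu_1=2\sup_k\|\lambda_kT_\Gamma z_k+(1-\lambda_k)z_k-z^\star\|+\sup_k\lambda_k\|\pi_k\|$; $\nu_2=2\sup_k\|e_k-e_{k+1}\|$; $C_1=\nu_1\sum_j\lambda_j\|\pi_j\|+\nu_2\overline\tau\sum_\ell(\ell+1)\|\pi_\ell\|$; $C_2=\sum_k\lambda_k\|\pi_k\|$. *)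

theory Defs
  imports "HOL-Analysis.Analysis" "HOL-Library.Landau_Symbols"
begin

text \<open>
  Throughout, \<open>T\<close> is the limit operator \<open>T\<^sub>\<Gamma>\<close>, \<open>S k\<close> is the operator \<open>T\<^bsub>\<Gamma>\<^sub>k\<^esub>\<close> used at step \<open>k\<close>,
  \<open>lam k\<close> is the relaxation parameter \<open>\<lambda>\<^sub>k\<close>, \<open>eps k\<close> is the additive error \<open>\<epsilon>\<^sub>k\<close>, and
  \<open>z k\<close> is the \<open>k\<close>-th iterate.
\<close>

definition fix_set :: "('a \<Rightarrow> 'a) \<Rightarrow> 'a set"
  where "fix_set T = {z. z = T z}"

abbreviation nonexpansive :: "('a::metric_space \<Rightarrow> 'a) \<Rightarrow> bool"
  where "nonexpansive T \<equiv> 1-lipschitz_on UNIV T"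

definition km_iteration ::
    "(nat \<Rightarrow> 'a::real_normed_vector \<Rightarrow> 'a) \<Rightarrow> (nat \<Rightarrow> real) \<Rightarrow> (nat \<Rightarrow> 'a) \<Rightarrow> (nat \<Rightarrow> 'a) \<Rightarrow> bool"
  where "km_iteration S lam eps z \<longleftrightarrow>
    (\<forall>k. z (Suc k) = z k + lam k *\<^sub>R (S k (z k) + eps k - z k))"

text \<open>
  For non-expansive operators and \<open>rho \<ge> 0\<close> the supremum ranges over a nonempty bounded set
  of reals, so that the real-valued \<open>SUP\<close> is the actual supremum.
\<close>
definition op_gap ::
    "('a::real_normed_vector \<Rightarrow> 'a) \<Rightarrow> (nat \<Rightarrow> 'a \<Rightarrow> 'a) \<Rightarrow> nat \<Rightarrow> real \<Rightarrow> real"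
  where "op_gap T S k rho = (SUP x\<in>{x. norm x \<le> rho}. norm (S k x - T x))"

definition pert ::
    "('a::real_normed_vector \<Rightarrow> 'a) \<Rightarrow> (nat \<Rightarrow> 'a \<Rightarrow> 'a) \<Rightarrow> (nat \<Rightarrow> 'a) \<Rightarrow> (nat \<Rightarrow> 'a) \<Rightarrow> nat \<Rightarrow> 'a"
  where "pert T S eps z k = (S k (z k) - T (z k)) + eps k"

definition resid ::
    "('a::real_normed_vector \<Rightarrow> 'a) \<Rightarrow> (nat \<Rightarrow> 'a \<Rightarrow> 'a) \<Rightarrow> (nat \<Rightarrow> real) \<Rightarrow> (nat \<Rightarrow> 'a) \<Rightarrow>
      (nat \<Rightarrow> 'a) \<Rightarrow> nat \<Rightarrow> 'a"
  where "resid T S lam eps z k = (z k - z (Suc k)) /\<^sub>R lam k + pert T S eps z k"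

lemma resid_eq:
  assumes "km_iteration S lam eps z" and "lam k \<noteq> 0"
  shows "resid T S lam eps z k = z k - T (z k)"
  using assms by (simp add: km_iteration_def resid_def pert_def)

definition Lam :: "(nat \<Rightarrow> real) \<Rightarrow> nat \<Rightarrow> real"
  where "Lam lam k = (\<Sum>j\<le>k. lam j)"

definition avg_resid ::
    "('a::real_normed_vector \<Rightarrow> 'a) \<Rightarrow> (nat \<Rightarrow> 'a \<Rightarrow> 'a) \<Rightarrow> (nat \<Rightarrow> real) \<Rightarrow> (nat \<Rightarrow> 'a) \<Rightarrow>
      (nat \<Rightarrow> 'a) \<Rightarrow> nat \<Rightarrow> 'a"
  where "avg_resid T S lam eps z k =
    (1 / Lam lam k) *\<^sub>R (\<Sum>j\<le>k. lam j *\<^sub>R resid T S lam eps z j)"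

definition init_dist :: "('a::real_normed_vector \<Rightarrow> 'a) \<Rightarrow> 'a \<Rightarrow> real"
  where "init_dist T x = (INF y\<in>fix_set T. norm (x - y))"

text \<open>
  The point \<open>z\<^sup>\<star>\<close> at which \<open>init_dist\<close> is attained.  In a Hilbert space it exists and is unique
  whenever \<open>T\<close> is non-expansive with a fixed point, because \<open>fix_set T\<close> is then nonempty, closed
  and convex.
\<close>
definition nearest_fix :: "('a::real_normed_vector \<Rightarrow> 'a) \<Rightarrow> 'a \<Rightarrow> 'a"
  where "nearest_fix T x = arg_min_on (\<lambda>y. norm (x - y)) (fix_set T)"

definition tau :: "(nat \<Rightarrow> real) \<Rightarrow> nat \<Rightarrow> real"
  where "tau lam k = lam k * (1 - lam k)"

text \<open>
  The constants below are extended nonnegative reals, since the finiteness of \<open>C1\<close> and \<open>C2\<close> is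
  something to be proved; all suprema and series are unconditional in this type.  As usual
  \<open>0 * \<infinity> = 0\<close>.
\<close>
definition nu1 ::
    "('a::real_normed_vector \<Rightarrow> 'a) \<Rightarrow> (nat \<Rightarrow> 'a \<Rightarrow> 'a) \<Rightarrow> (nat \<Rightarrow> real) \<Rightarrow> (nat \<Rightarrow> 'a) \<Rightarrow>
      (nat \<Rightarrow> 'a) \<Rightarrow> ennreal"
  where "nu1 T S lam eps z =
    2 * (SUP k. ennreal (norm (lam k *\<^sub>R T (z k) + (1 - lam k) *\<^sub>R z k - nearest_fix T (z 0))))
    + (SUP k. ennreal (lam k * norm (pert T S eps z k)))"

definition nu2 ::
    "('a::real_normed_vector \<Rightarrow> 'a) \<Rightarrow> (nat \<Rightarrow> 'a \<Rightarrow> 'a) \<Rightarrow> (nat \<Rightarrow> real) \<Rightarrow> (nat \<Rightarrow> 'a) \<Rightarrow>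
      (nat \<Rightarrow> 'a) \<Rightarrow> ennreal"
  where "nu2 T S lam eps z =
    2 * (SUP k. ennreal (norm (resid T S lam eps z k - resid T S lam eps z (Suc k))))"

definition C1 ::
    "('a::real_normed_vector \<Rightarrow> 'a) \<Rightarrow> (nat \<Rightarrow> 'a \<Rightarrow> 'a) \<Rightarrow> (nat \<Rightarrow> real) \<Rightarrow> (nat \<Rightarrow> 'a) \<Rightarrow>
      (nat \<Rightarrow> 'a) \<Rightarrow> ennreal"
  where "C1 T S lam eps z =
    nu1 T S lam eps z * (\<Sum>j. ennreal (lam j * norm (pert T S eps z j)))
    + nu2 T S lam eps z * (SUP k. ennreal (tau lam k))
        * (\<Sum>l. ennreal (real (l + 1) * norm (pert T S eps z l)))"

definition C2 ::
    "('a::real_normed_vector \<Rightarrow> 'a) \<Rightarrow> (nat \<Rightarrow> 'a \<Rightarrow> 'a) \<Rightarrow> (nat \<Rightarrow> real) \<Rightarrow> (nat \<Rightarrow> 'a) \<Rightarrow>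
      (nat \<Rightarrow> 'a) \<Rightarrow> ennreal"
  where "C2 T S lam eps z = (\<Sum>k. ennreal (lam k * norm (pert T S eps z k)))"

end

theory Submission
  imports Defs
begin

text \<open>
  Everything is measured against a fixed point \<open>p\<close> of \<open>T\<close> nearest to \<open>z 0\<close>; it exists because the
  fixed point set of a non-expansive map on a Hilbert space is closed and convex.  Write \<open>\<pi>\<^sub>k\<close> for
  the total perturbation and \<open>e\<^sub>k = z\<^sub>k - T z\<^sub>k\<close> for the residual, so that one step is
  \<open>z\<^sub>k\<^sub>+\<^sub>1 = w\<^sub>k + \<lambda>\<^sub>k \<pi>\<^sub>k\<close> with \<open>w\<^sub>k = (1 - \<lambda>\<^sub>k) z\<^sub>k + \<lambda>\<^sub>k T z\<^sub>k\<close>.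

  The perturbation depends on the iterates through \<open>S k (z k) - T (z k)\<close>, so its summability cannot
  be read off the hypotheses.  Comparing \<open>S k (z k)\<close> with \<open>S k p\<close> instead, only the gap between
  \<open>S k\<close> and \<open>T\<close> at the single point \<open>p\<close> enters; hence the iterates stay in some ball, and then the
  gap on that ball controls \<open>\<pi>\<^sub>k\<close>.

  For the averaged residual, \<open>\<lambda>\<^sub>j e\<^sub>j = z\<^sub>j - z\<^sub>j\<^sub>+\<^sub>1 + \<lambda>\<^sub>j \<pi>\<^sub>j\<close> telescopes, and the distance of \<open>z\<^sub>j\<close> to
  \<open>p\<close> grows in total by at most \<open>\<Sum> \<lambda>\<^sub>j \<parallel>\<pi>\<^sub>j\<parallel>\<close>.

  For the pointwise residual, two inequalities are combined.  First, non-expansiveness and the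
  strong convexity of the squared norm give \<open>\<parallel>w\<^sub>k - p\<parallel>\<^sup>2 \<le> \<parallel>z\<^sub>k - p\<parallel>\<^sup>2 - \<tau>\<^sub>k \<parallel>e\<^sub>k\<parallel>\<^sup>2\<close>, so that \<open>\<Sum> \<tau>\<^sub>k \<parallel>e\<^sub>k\<parallel>\<^sup>2\<close> is bounded (lemma
  \<open>energy_bound\<close>).  Second, the residuals are almost decreasing,
  \<open>\<parallel>e\<^sub>k\<^sub>+\<^sub>1\<parallel>\<^sup>2 \<le> \<parallel>e\<^sub>k\<parallel>\<^sup>2 + \<nu>\<^sub>2 \<parallel>\<pi>\<^sub>k\<parallel>\<close>, because \<open>Id - T\<close> is cocoercive (lemma \<open>residual_step\<close>).  So the last
  residual is, up to the accumulated perturbations, the smallest of the \<open>k + 1\<close> residuals whose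
  weighted sum of squares is bounded.  Replacing every \<open>e\<^sub>j\<close> by \<open>e\<^sub>k\<close> in that sum counts \<open>\<parallel>\<pi>\<^sub>l\<parallel>\<close> once for each
  \<open>j \<le> l\<close>, which is where the weights \<open>l + 1\<close> in \<open>C1\<close> come from.
\<close>

section \<open>Nearest fixed points in Hilbert space\<close>

text \<open>The defect \<open>t (1 - t) \<parallel>a - b\<parallel>\<^sup>2\<close> in the convexity of the squared norm is the source of the
  parallelogram law, of the convexity of fixed point sets and of the decrease along the iteration.\<close>

lemma norm_convex_combination_sq:
  fixes a b :: "'a::real_inner"
  shows "(norm ((1 - t) *\<^sub>R a + t *\<^sub>R b))\<^sup>2
    = (1 - t) * (norm a)\<^sup>2 + t * (norm b)\<^sup>2 - t * (1 - t) * (norm (a - b))\<^sup>2"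
  unfolding power2_norm_eq_inner
  by (simp add: inner_add_left inner_add_right inner_diff_left inner_diff_right inner_commute
      algebra_simps power2_eq_square)

text \<open>A minimizing sequence is Cauchy: midpoints of \<open>C\<close> stay in \<open>C\<close>, hence at distance at least the
  infimum from \<open>x\<close>, and the parallelogram law then forces nearly optimal points to be close.\<close>

lemma nearest_point_exists:
  fixes C :: "'a::{real_inner, complete_space} set"
  assumes "closed C" "convex C" "C \<noteq> {}"
  shows "\<exists>y\<in>C. \<forall>v\<in>C. norm (x - y) \<le> norm (x - v)"
proof -
  define d where "d = (INF y\<in>C. norm (x - y))"
  have bdd: "bdd_below ((\<lambda>y. norm (x - y)) ` C)"
    by (rule bdd_belowI[of _ 0]) auto
  have lower: "d \<le> norm (x - y)" if "y \<in> C" for y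
    unfolding d_def using bdd that by (rule cINF_lower)
  have d0: "0 \<le> d"
    unfolding d_def using assms(3) by (intro cINF_greatest) auto
  have "\<exists>y\<in>C. norm (x - y) < d + 1 / real (Suc n)" for n
    using cINF_less_iff[OF assms(3) bdd, of "d + 1 / real (Suc n)"] by (simp add: d_def)
  then obtain y where yC: "\<And>n. y n \<in> C" and y_lt: "\<And>n. norm (x - y n) < d + 1 / real (Suc n)"
    by metis
  have "(\<lambda>n. d + 1 / real (Suc n)) \<longlonglongrightarrow> d + 0"
    by (intro tendsto_add tendsto_const LIMSEQ_Suc[OF lim_1_over_n])
  then have upper: "(\<lambda>n. d + 1 / real (Suc n)) \<longlonglongrightarrow> d"
    by simp
  have lim: "(\<lambda>n. norm (x - y n)) \<longlonglongrightarrow> d"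
  proof (rule tendsto_sandwich[OF _ _ tendsto_const upper])
    show "eventually (\<lambda>n. d \<le> norm (x - y n)) sequentially"
      by (intro always_eventually allI lower yC)
    show "eventually (\<lambda>n. norm (x - y n) \<le> d + 1 / real (Suc n)) sequentially"
      by (intro always_eventually allI less_imp_le y_lt)
  qed
  have pair: "(norm (y m - y n))\<^sup>2 \<le> 2 * (norm (x - y m))\<^sup>2 + 2 * (norm (x - y n))\<^sup>2 - 4 * d\<^sup>2" for m n
  proof -
    let ?c = "(1 - 1/2) *\<^sub>R y m + (1/2) *\<^sub>R y n"
    have "?c \<in> C"
      using assms(2) yC by (intro convexD) auto
    then have "d\<^sup>2 \<le> (norm (x - ?c))\<^sup>2"
      using lower d0 by (intro power_mono) auto
    moreover have "x - ?c = (1 - 1/2) *\<^sub>R (x - y m) + (1/2) *\<^sub>R (x - y n)"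
      by (simp add: algebra_simps flip: scaleR_left.add)
    ultimately show ?thesis
      using norm_convex_combination_sq[of "1/2" "x - y m" "x - y n"]
      by (simp add: norm_minus_commute)
  qed
  have "Cauchy y"
  proof (rule CauchyI)
    fix e :: real assume e: "0 < e"
    have "(\<lambda>n. (norm (x - y n))\<^sup>2) \<longlonglongrightarrow> d\<^sup>2"
      by (intro tendsto_intros lim)
    then have "eventually (\<lambda>n. (norm (x - y n))\<^sup>2 < d\<^sup>2 + e\<^sup>2 / 4) sequentially"
      using e by (intro order_tendstoD) auto
    then obtain N where N: "\<And>n. N \<le> n \<Longrightarrow> (norm (x - y n))\<^sup>2 < d\<^sup>2 + e\<^sup>2 / 4"
      by (auto simp: eventually_sequentially)
    have "norm (y m - y n) < e" if "N \<le> m" "N \<le> n" for m n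
    proof -
      have "(norm (y m - y n))\<^sup>2 < e\<^sup>2"
        using pair[of m n] N[OF that(1)] N[OF that(2)] by linarith
      then show ?thesis
        using power2_less_imp_less[of "norm (y m - y n)" e] e by simp
    qed
    then show "\<exists>N. \<forall>m\<ge>N. \<forall>n\<ge>N. norm (y m - y n) < e"
      by blast
  qed
  then obtain l where l: "y \<longlonglongrightarrow> l"
    by (auto simp: Cauchy_convergent_iff convergent_def)
  have "l \<in> C"
    using closed_sequentially[OF assms(1)] yC l by blast
  moreover have "norm (x - l) = d"
    using LIMSEQ_unique[OF tendsto_norm[OF tendsto_diff[OF tendsto_const l]] lim] .
  ultimately show ?thesis
    using lower by auto
qed

lemma nonexpansive_norm_le:
  fixes T :: "'a::real_normed_vector \<Rightarrow> 'a"
  assumes "nonexpansive T"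
  shows "norm (T x - T y) \<le> norm (x - y)"
  using lipschitz_onD[OF assms, of x y] by (simp add: dist_norm)

lemma closed_fix_set:
  fixes T :: "'a::real_normed_vector \<Rightarrow> 'a"
  assumes "nonexpansive T"
  shows "closed (fix_set T)"
  unfolding fix_set_def
  using lipschitz_on_continuous_on[OF assms] by (intro closed_Collect_eq continuous_on_id)

text \<open>If \<open>x\<close> and \<open>y\<close> are fixed and \<open>m\<close> lies between them, then \<open>T m\<close> is at most as far from \<open>x\<close> and
  from \<open>y\<close> as \<open>m\<close> is; in a strictly convex norm only \<open>m\<close> itself has this property.\<close>

lemma convex_fix_set:
  fixes T :: "'a::real_inner \<Rightarrow> 'a"
  assumes "nonexpansive T"
  shows "convex (fix_set T)"
  unfolding convex_alt
proof (intro ballI allI impI)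
  fix x y and t :: real
  assume "x \<in> fix_set T" "y \<in> fix_set T" and t: "0 \<le> t \<and> t \<le> 1"
  then have x: "T x = x" and y: "T y = y"
    by (auto simp: fix_set_def)
  define m where "m = (1 - t) *\<^sub>R x + t *\<^sub>R y"
  have mx: "m - x = t *\<^sub>R (y - x)" and my: "m - y = (1 - t) *\<^sub>R (x - y)"
    by (auto simp: m_def algebra_simps)
  have "norm (T m - x) \<le> t * norm (x - y)"
    using nonexpansive_norm_le[OF assms, of m x] x mx t by (simp add: norm_minus_commute)
  then have dx: "(norm (T m - x))\<^sup>2 \<le> t\<^sup>2 * (norm (x - y))\<^sup>2"
    using power_mono[of "norm (T m - x)" "t * norm (x - y)" 2] by (simp add: power_mult_distrib)
  have "norm (T m - y) \<le> (1 - t) * norm (x - y)"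
    using nonexpansive_norm_le[OF assms, of m y] y my t by simp
  then have dy: "(norm (T m - y))\<^sup>2 \<le> (1 - t)\<^sup>2 * (norm (x - y))\<^sup>2"
    using power_mono[of "norm (T m - y)" "(1 - t) * norm (x - y)" 2]
    by (simp add: power_mult_distrib)
  have "T m - m = (1 - t) *\<^sub>R (T m - x) + t *\<^sub>R (T m - y)"
    by (simp add: m_def algebra_simps)
  then have "(norm (T m - m))\<^sup>2
      = (1 - t) * (norm (T m - x))\<^sup>2 + t * (norm (T m - y))\<^sup>2 - t * (1 - t) * (norm (x - y))\<^sup>2"
    using norm_convex_combination_sq[of t "T m - x" "T m - y"] by (simp add: norm_minus_commute)
  also have "\<dots> \<le> (1 - t) * (t\<^sup>2 * (norm (x - y))\<^sup>2) + t * ((1 - t)\<^sup>2 * (norm (x - y))\<^sup>2)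
      - t * (1 - t) * (norm (x - y))\<^sup>2"
    using t dx dy by (intro diff_right_mono add_mono mult_left_mono) auto
  also have "\<dots> = 0"
    by (simp add: algebra_simps power2_eq_square)
  finally show "m \<in> fix_set T"
    by (simp add: fix_set_def)
qed

lemma nearest_fix_properties:
  fixes T :: "'a::{real_inner, complete_space} \<Rightarrow> 'a"
  assumes "nonexpansive T" "fix_set T \<noteq> {}"
  shows "T (nearest_fix T x) = nearest_fix T x"
    and "norm (x - nearest_fix T x) = init_dist T x"
proof -
  obtain y where y: "y \<in> fix_set T" "\<forall>v\<in>fix_set T. norm (x - y) \<le> norm (x - v)"
    using nearest_point_exists[OF closed_fix_set convex_fix_set] assms by blast
  then have "is_arg_min (\<lambda>y. norm (x - y)) (\<lambda>y. y \<in> fix_set T) y"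
    by (auto simp: is_arg_min_linorder)
  then have "is_arg_min (\<lambda>y. norm (x - y)) (\<lambda>y. y \<in> fix_set T) (nearest_fix T x)"
    unfolding nearest_fix_def arg_min_on_def arg_min_def by (rule someI)
  then have mem: "nearest_fix T x \<in> fix_set T"
    and min: "\<And>v. v \<in> fix_set T \<Longrightarrow> norm (x - nearest_fix T x) \<le> norm (x - v)"
    by (auto simp: is_arg_min_linorder)
  show "T (nearest_fix T x) = nearest_fix T x"
    using mem by (simp add: fix_set_def)
  show "norm (x - nearest_fix T x) = init_dist T x"
    unfolding init_dist_def using mem min by (intro cInf_eq_minimum[symmetric]) auto
qed

section \<open>Sequences with summable increments and extended real constants\<close>

lemma le_add_sum_increments:
  fixes u a :: "nat \<Rightarrow> real"
  assumes "\<And>k. u (Suc k) \<le> u k + a k" "j \<le> k"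
  shows "u k \<le> u j + (\<Sum>l = j..<k. a l)"
  using assms(2)
proof (induction k rule: dec_induct)
  case (step n)
  then show ?case
    using assms(1)[of n] by simp
qed simp

lemma ennreal_SUP_of_bounded:
  fixes f :: "nat \<Rightarrow> real"
  assumes "\<And>k. 0 \<le> f k" "\<And>k. f k \<le> B"
  shows "(SUP k. ennreal (f k)) = ennreal (SUP k. f k)"
    and "\<And>k. f k \<le> (SUP k. f k)"
    and "0 \<le> (SUP k. f k)"
proof -
  have bdd: "bdd_above (range f)"
    using assms(2) by (intro bdd_aboveI[of _ B]) auto
  show upper: "f k \<le> (SUP k. f k)" for k
    using bdd by (intro cSUP_upper) auto
  show nonneg: "0 \<le> (SUP k. f k)"
    using assms(1)[of 0] upper[of 0] by linarith
  have "(SUP k. ennreal (f k)) \<le> ennreal (SUP k. f k)"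
    by (intro SUP_least ennreal_leI upper)
  moreover have "ennreal (SUP k. f k) \<le> (SUP k. ennreal (f k))"
  proof (cases "(SUP k. ennreal (f k)) = top")
    case True
    show ?thesis
      unfolding True by (rule top_greatest)
  next
    case False
    then obtain r where r: "0 \<le> r" "(SUP k. ennreal (f k)) = ennreal r"
      by (cases "SUP k. ennreal (f k)") auto
    have "f k \<le> r" for k
      using r SUP_upper[of k UNIV "\<lambda>k. ennreal (f k)"] by (simp add: ennreal_le_iff)
    then have "(SUP k. f k) \<le> r"
      by (intro cSUP_least) auto
    then show ?thesis
      using r by (simp add: ennreal_leI)
  qed
  ultimately show "(SUP k. ennreal (f k)) = ennreal (SUP k. f k)"
    by (rule antisym)
qed

section \<open>Perturbed relaxed iterations\<close>

text \<open>The gap is finite on balls because both operators are Lipschitz.\<close>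

lemma norm_diff_le_op_gap:
  fixes T :: "'a::real_normed_vector \<Rightarrow> 'a"
  assumes "nonexpansive T" "nonexpansive (S k)" "norm x \<le> rho"
  shows "norm (S k x - T x) \<le> op_gap T S k rho"
proof -
  have "norm (S k y - T y) \<le> norm (S k 0 - T 0) + 2 * rho" if "norm y \<le> rho" for y
  proof -
    have "norm (S k y - T y) \<le> norm (S k y - S k 0) + norm (S k 0 - T 0) + norm (T 0 - T y)"
      using norm_triangle_ineq[of "S k y - S k 0" "S k 0 - T y"]
        norm_triangle_ineq[of "S k 0 - T 0" "T 0 - T y"] by simp
    then show ?thesis
      using nonexpansive_norm_le[OF assms(1), of 0 y] nonexpansive_norm_le[OF assms(2), of y 0] that
      by simp
  qed
  then have "bdd_above ((\<lambda>y. norm (S k y - T y)) ` {y. norm y \<le> rho})"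
    by (auto intro!: bdd_aboveI)
  then show ?thesis
    unfolding op_gap_def using assms(3) by (intro cSUP_upper) auto
qed

locale perturbed_iteration =
  fixes T :: "'a::real_inner \<Rightarrow> 'a"
    and S :: "nat \<Rightarrow> 'a \<Rightarrow> 'a"
    and lam :: "nat \<Rightarrow> real"
    and eps z :: "nat \<Rightarrow> 'a"
    and p :: 'a
  assumes nonexpansive_T: "nonexpansive T"
    and nonexpansive_S: "\<And>k. nonexpansive (S k)"
    and iteration: "km_iteration S lam eps z"
    and lam_pos: "\<And>k. 0 < lam k"
    and lam_le_1: "\<And>k. lam k \<le> 1"
    and fixed: "T p = p"
begin

abbreviation pi_norm :: "nat \<Rightarrow> real"
  where "pi_norm k \<equiv> norm (pert T S eps z k)"

abbreviation e :: "nat \<Rightarrow> 'a"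
  where "e \<equiv> resid T S lam eps z"

definition w :: "nat \<Rightarrow> 'a"
  where "w k = lam k *\<^sub>R T (z k) + (1 - lam k) *\<^sub>R z k"

lemma e_eq: "e k = z k - T (z k)"
  using resid_eq[OF iteration] lam_pos[of k] by simp

lemma z_Suc: "z (Suc k) = w k + lam k *\<^sub>R pert T S eps z k"
  using iteration unfolding km_iteration_def w_def pert_def by (simp add: algebra_simps)

lemma lam_scaleR_e: "lam k *\<^sub>R e k = z k - z (Suc k) + lam k *\<^sub>R pert T S eps z k"
  unfolding z_Suc w_def e_eq by (simp add: algebra_simps)

lemma norm_T_diff_fixed: "norm (T x - p) \<le> norm (x - p)"
  using nonexpansive_norm_le[OF nonexpansive_T, of x p] fixed by simp

lemma w_dist_sq: "(norm (w k - p))\<^sup>2 \<le> (norm (z k - p))\<^sup>2 - tau lam k * (norm (e k))\<^sup>2"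
proof -
  have "w k - p = (1 - lam k) *\<^sub>R (z k - p) + lam k *\<^sub>R (T (z k) - p)"
    by (simp add: w_def algebra_simps)
  then have "(norm (w k - p))\<^sup>2
      = (1 - lam k) * (norm (z k - p))\<^sup>2 + lam k * (norm (T (z k) - p))\<^sup>2
        - tau lam k * (norm (e k))\<^sup>2"
    using norm_convex_combination_sq[of "lam k" "z k - p" "T (z k) - p"]
    by (simp add: e_eq tau_def)
  also have "\<dots> \<le> (1 - lam k) * (norm (z k - p))\<^sup>2 + lam k * (norm (z k - p))\<^sup>2
        - tau lam k * (norm (e k))\<^sup>2"
    using lam_pos[of k] norm_T_diff_fixed[of "z k"]
    by (intro diff_right_mono add_left_mono mult_left_mono power_mono) auto
  finally show ?thesis
    by (simp add: algebra_simps)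
qed

lemma w_dist: "norm (w k - p) \<le> norm (z k - p)"
proof -
  have "0 \<le> tau lam k * (norm (e k))\<^sup>2"
    using lam_pos[of k] lam_le_1[of k] by (simp add: tau_def)
  then have "(norm (w k - p))\<^sup>2 \<le> (norm (z k - p))\<^sup>2"
    using w_dist_sq[of k] by linarith
  then show ?thesis
    by (rule power2_le_imp_le) simp
qed

lemma z_dist_Suc_w: "norm (z (Suc k) - p) \<le> norm (w k - p) + lam k * pi_norm k"
proof -
  have "z (Suc k) - p = (w k - p) + lam k *\<^sub>R pert T S eps z k"
    by (simp add: z_Suc)
  then have "norm (z (Suc k) - p) \<le> norm (w k - p) + norm (lam k *\<^sub>R pert T S eps z k)"
    by (simp only: norm_triangle_ineq)
  then show ?thesis
    using lam_pos[of k] by simp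
qed

lemma z_dist_Suc: "norm (z (Suc k) - p) \<le> norm (z k - p) + lam k * pi_norm k"
  using z_dist_Suc_w[of k] w_dist[of k] by linarith

lemma z_dist: "norm (z k - p) \<le> norm (z 0 - p) + (\<Sum>j<k. lam j * pi_norm j)"
  using le_add_sum_increments[of "\<lambda>k. norm (z k - p)" "\<lambda>k. lam k * pi_norm k" 0 k] z_dist_Suc
  by (simp add: atLeast0LessThan)

subsection \<open>Boundedness of the iterates and summability of the perturbations\<close>

lemma gap_le: "norm x \<le> rho \<Longrightarrow> norm (S k x - T x) \<le> op_gap T S k rho"
  using nonexpansive_T nonexpansive_S by (rule norm_diff_le_op_gap)

lemma op_gap_nonneg: "0 \<le> rho \<Longrightarrow> 0 \<le> op_gap T S k rho"
  using order_trans[OF norm_ge_zero gap_le[of 0 rho k]] by simp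

text \<open>Here \<open>S k (z k)\<close> is compared with \<open>S k p\<close> rather than with \<open>T (z k)\<close>: the resulting error is
  the gap at the fixed point \<open>p\<close>, which needs no prior bound on the iterates.\<close>

lemma z_dist_Suc_gap:
  "norm (z (Suc k) - p) \<le> norm (z k - p) + lam k * (op_gap T S k (norm p) + norm (eps k))"
proof -
  have "z (Suc k) - p = (1 - lam k) *\<^sub>R (z k - p)
      + lam k *\<^sub>R ((S k (z k) - S k p) + (S k p - T p) + eps k)"
    using iteration fixed unfolding km_iteration_def by (simp add: algebra_simps)
  then have "norm (z (Suc k) - p) \<le> (1 - lam k) * norm (z k - p)
      + lam k * norm ((S k (z k) - S k p) + (S k p - T p) + eps k)"
    using norm_triangle_ineq[of "(1 - lam k) *\<^sub>R (z k - p)"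
        "lam k *\<^sub>R ((S k (z k) - S k p) + (S k p - T p) + eps k)"] lam_pos[of k] lam_le_1[of k]
    by simp
  also have "norm ((S k (z k) - S k p) + (S k p - T p) + eps k)
      \<le> norm (z k - p) + op_gap T S k (norm p) + norm (eps k)"
    using gap_le[of p "norm p" k]
      nonexpansive_norm_le[OF nonexpansive_S[of k], of "z k" p]
      norm_triangle_ineq[of "(S k (z k) - S k p) + (S k p - T p)" "eps k"]
      norm_triangle_ineq[of "S k (z k) - S k p" "S k p - T p"]
    by linarith
  finally show ?thesis
    using lam_pos[of k] by (simp add: algebra_simps)
qed

text \<open>The two rates assume summability with the weights \<open>k + 1\<close> and \<open>\<lambda>\<^sub>k\<close> respectively; both
  dominate \<open>\<lambda>\<^sub>k\<close>, which is what the boundedness of the iterates requires.\<close>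

context
  fixes weight :: "nat \<Rightarrow> real"
  assumes lam_le_weight: "\<And>k. lam k \<le> weight k"
    and summable_eps: "summable (\<lambda>k. weight k * norm (eps k))"
    and summable_gap: "\<And>rho. 0 \<le> rho \<Longrightarrow> summable (\<lambda>k. weight k * op_gap T S k rho)"
begin

lemma z_bounded: "\<exists>R\<ge>0. \<forall>k. norm (z k) \<le> R \<and> norm (z k - p) \<le> R"
proof -
  define a where "a k = lam k * (op_gap T S k (norm p) + norm (eps k))" for k
  have a_nonneg: "0 \<le> a k" for k
    unfolding a_def using lam_pos[of k] op_gap_nonneg[of "norm p" k] by simp
  have "summable (\<lambda>k. weight k * op_gap T S k (norm p) + weight k * norm (eps k))"
    by (intro summable_add summable_eps summable_gap norm_ge_zero)
  then have "summable a"
  proof (rule summable_comparison_test')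
    show "norm (a n) \<le> weight n * op_gap T S n (norm p) + weight n * norm (eps n)"
      if "0 \<le> n" for n
      using a_nonneg[of n] op_gap_nonneg[of "norm p" n]
        mult_right_mono[OF lam_le_weight[of n], of "op_gap T S n (norm p) + norm (eps n)"]
      by (simp add: a_def algebra_simps)
  qed
  then have sum_le: "(\<Sum>j<k. a j) \<le> suminf a" for k
    using a_nonneg by (intro sum_le_suminf) auto
  have dist: "norm (z k - p) \<le> norm (z 0 - p) + suminf a" for k
    using le_add_sum_increments[of "\<lambda>k. norm (z k - p)" a 0 k] z_dist_Suc_gap sum_le[of k]
    by (simp add: atLeast0LessThan a_def)
  have "norm (z k) \<le> norm (z 0 - p) + suminf a + norm p" for k
    using dist[of k] norm_triangle_ineq2[of "z k" p] by linarith
  moreover have "norm (z k - p) \<le> norm (z 0 - p) + suminf a + norm p" for k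
    using dist[of k] norm_ge_zero[of p] by linarith
  moreover have "0 \<le> norm (z 0 - p) + suminf a + norm p"
    using sum_le[of 0] by simp
  ultimately show ?thesis
    by blast
qed

lemma summable_weight_pert: "summable (\<lambda>k. weight k * pi_norm k)"
proof -
  obtain R where R: "0 \<le> R" "\<And>k. norm (z k) \<le> R"
    using z_bounded by blast
  have weight_nonneg: "0 \<le> weight k" for k
    using lam_pos[of k] lam_le_weight[of k] by linarith
  have "summable (\<lambda>k. weight k * op_gap T S k R + weight k * norm (eps k))"
    by (intro summable_add summable_eps summable_gap R)
  then show ?thesis
  proof (rule summable_comparison_test')
    fix k :: nat
    have "pi_norm k \<le> op_gap T S k R + norm (eps k)"
      unfolding pert_def
      using gap_le[OF R(2), of k k]
        norm_triangle_ineq[of "S k (z k) - T (z k)" "eps k"] by linarith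
    from mult_left_mono[OF this weight_nonneg]
    show "norm (weight k * pi_norm k) \<le> weight k * op_gap T S k R + weight k * norm (eps k)"
      using weight_nonneg by (simp add: abs_mult algebra_simps)
  qed
qed

lemma summable_lam_pert: "summable (\<lambda>k. lam k * pi_norm k)"
  using summable_weight_pert
proof (rule summable_comparison_test')
  show "norm (lam k * pi_norm k) \<le> weight k * pi_norm k" if "0 \<le> k" for k
    using lam_pos[of k] lam_le_weight[of k] by (simp add: abs_mult mult_right_mono)
qed

end

subsection \<open>The averaged residual\<close>

lemma Lam_pos: "0 < Lam lam k"
  unfolding Lam_def using lam_pos by (intro sum_pos) auto

lemma norm_avg_resid_le:
  assumes "summable (\<lambda>k. lam k * pi_norm k)"
  shows "norm (avg_resid T S lam eps z k)
    \<le> 2 * (norm (z 0 - p) + (\<Sum>j. lam j * pi_norm j)) / Lam lam k"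
proof -
  let ?P = "\<Sum>j. lam j * pi_norm j"
  have nonneg: "0 \<le> lam j * pi_norm j" for j
    using lam_pos[of j] by simp
  have partial: "(\<Sum>j\<le>n. lam j * pi_norm j) \<le> ?P" for n
    using assms nonneg by (intro sum_le_suminf) auto
  have "(\<Sum>j\<le>k. lam j *\<^sub>R e j)
      = (\<Sum>j<Suc k. z j - z (Suc j)) + (\<Sum>j\<le>k. lam j *\<^sub>R pert T S eps z j)"
    unfolding lam_scaleR_e sum.distrib lessThan_Suc_atMost ..
  also have "(\<Sum>j<Suc k. z j - z (Suc j)) = (z 0 - p) - (z (Suc k) - p)"
    by (simp only: sum_lessThan_telescope') simp
  finally have split: "(\<Sum>j\<le>k. lam j *\<^sub>R e j)
      = ((z 0 - p) - (z (Suc k) - p)) + (\<Sum>j\<le>k. lam j *\<^sub>R pert T S eps z j)" .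
  have z_le: "norm (z (Suc k) - p) \<le> norm (z 0 - p) + ?P"
    using order_trans[OF z_dist add_left_mono] partial[of k] by (simp only: lessThan_Suc_atMost)
  have "norm (\<Sum>j\<le>k. lam j *\<^sub>R pert T S eps z j) \<le> (\<Sum>j\<le>k. lam j * pi_norm j)"
    using lam_pos by (intro sum_norm_le) (simp add: abs_of_pos)
  then have pert_le: "norm (\<Sum>j\<le>k. lam j *\<^sub>R pert T S eps z j) \<le> ?P"
    using partial by (rule order_trans)
  have "norm (\<Sum>j\<le>k. lam j *\<^sub>R e j) \<le> (norm (z 0 - p) + norm (z (Suc k) - p)) + ?P"
    unfolding split by (rule norm_triangle_mono[OF norm_triangle_ineq4 pert_le])
  also have "\<dots> \<le> (norm (z 0 - p) + (norm (z 0 - p) + ?P)) + ?P"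
    by (intro add_right_mono add_left_mono z_le)
  finally have "norm (\<Sum>j\<le>k. lam j *\<^sub>R e j) \<le> 2 * (norm (z 0 - p) + ?P)"
    by (simp only: mult_2 distrib_left add_ac)
  then show ?thesis
    using Lam_pos[of k] by (simp add: avg_resid_def divide_right_mono)
qed

subsection \<open>The pointwise residual\<close>

text \<open>The step \<open>z\<^sub>k - z\<^sub>k\<^sub>+\<^sub>1\<close> is \<open>\<lambda>\<^sub>k (e\<^sub>k - \<pi>\<^sub>k)\<close>, and \<open>Id - T\<close> is \<open>1/2\<close>-cocoercive.  With
  \<open>d = e\<^sub>k - e\<^sub>k\<^sub>+\<^sub>1\<close> this bounds \<open>\<langle>d, e\<^sub>k\<rangle>\<close> from below by \<open>\<parallel>d\<parallel>\<^sup>2 / (2 \<lambda>\<^sub>k) + \<langle>d, \<pi>\<^sub>k\<rangle>\<close>, and since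
  \<open>\<lambda>\<^sub>k \<le> 1\<close> the quadratic term absorbs the \<open>\<parallel>d\<parallel>\<^sup>2\<close> in the expansion of \<open>\<parallel>e\<^sub>k - d\<parallel>\<^sup>2\<close>.\<close>

lemma residual_step:
  "(norm (e (Suc k)))\<^sup>2 \<le> (norm (e k))\<^sup>2 + 2 * norm (e k - e (Suc k)) * pi_norm k"
proof -
  define d where "d = e k - e (Suc k)"
  define s where "s = z k - z (Suc k)"
  let ?pi = "pert T S eps z k"
  have "norm (s - d) \<le> norm s"
    using nonexpansive_norm_le[OF nonexpansive_T, of "z k" "z (Suc k)"]
    by (simp add: s_def d_def e_eq algebra_simps)
  then have "(norm (s - d))\<^sup>2 \<le> (norm s)\<^sup>2"
    by (intro power_mono) auto
  then have cocoercive: "(norm d)\<^sup>2 \<le> 2 * inner d s"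
    by (simp add: power2_norm_eq_inner inner_diff_left inner_diff_right inner_commute)
  have s: "s = lam k *\<^sub>R (e k - ?pi)"
    using lam_scaleR_e[of k] by (simp add: s_def algebra_simps)
  have "lam k * (norm d)\<^sup>2 \<le> lam k * (2 * inner d (e k - ?pi))"
  proof -
    have "lam k * (norm d)\<^sup>2 \<le> 1 * (norm d)\<^sup>2"
      using lam_le_1[of k] by (intro mult_right_mono) auto
    then show ?thesis
      using cocoercive unfolding s by simp
  qed
  then have "(norm d)\<^sup>2 \<le> 2 * inner d (e k) - 2 * inner d ?pi"
    using lam_pos[of k] by (simp add: inner_diff_right)
  moreover have "(norm (e (Suc k)))\<^sup>2 = (norm (e k))\<^sup>2 - 2 * inner d (e k) + (norm d)\<^sup>2"
    by (simp add: d_def power2_norm_eq_inner inner_diff_left inner_diff_right inner_commute)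
  moreover have "- inner d ?pi \<le> norm d * pi_norm k"
    using Cauchy_Schwarz_ineq2[of d ?pi] by linarith
  ultimately show ?thesis
    unfolding d_def[symmetric] by linarith
qed

text \<open>The square of \<open>\<parallel>w\<^sub>k - p\<parallel> + \<lambda>\<^sub>k \<parallel>\<pi>\<^sub>k\<parallel>\<close> exceeds \<open>\<parallel>w\<^sub>k - p\<parallel>\<^sup>2\<close> by \<open>\<lambda>\<^sub>k \<parallel>\<pi>\<^sub>k\<parallel>\<close> times a bounded
  factor, which explains the shape of \<open>\<nu>\<^sub>1\<close>; summing \<open>w_dist_sq\<close> telescopes.\<close>

lemma energy_bound:
  assumes "\<And>k. norm (w k - p) \<le> W" "\<And>k. lam k * pi_norm k \<le> M"
  shows "(\<Sum>j\<le>k. tau lam j * (norm (e j))\<^sup>2)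
    \<le> (norm (z 0 - p))\<^sup>2 + (2 * W + M) * (\<Sum>j\<le>k. lam j * pi_norm j)"
proof -
  have step: "(norm (z (Suc k) - p))\<^sup>2
      \<le> (norm (z k - p))\<^sup>2 + ((2 * W + M) * (lam k * pi_norm k) - tau lam k * (norm (e k))\<^sup>2)" for k
  proof -
    let ?b = "lam k * pi_norm k"
    have b: "0 \<le> ?b"
      using lam_pos[of k] by simp
    have "(norm (z (Suc k) - p))\<^sup>2 \<le> (norm (w k - p) + ?b)\<^sup>2"
      using z_dist_Suc_w[of k] by (intro power_mono) auto
    also have "\<dots> = (norm (w k - p))\<^sup>2 + (2 * norm (w k - p) + ?b) * ?b"
      by (simp add: power2_eq_square algebra_simps)
    also have "\<dots> \<le> (norm (w k - p))\<^sup>2 + (2 * W + M) * ?b"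
      using assms[of k] b by (intro add_left_mono mult_right_mono add_mono) auto
    finally show ?thesis
      using w_dist_sq[of k] by linarith
  qed
  have "(norm (z (Suc k) - p))\<^sup>2 \<le> (norm (z 0 - p))\<^sup>2
      + (\<Sum>l<Suc k. (2 * W + M) * (lam l * pi_norm l) - tau lam l * (norm (e l))\<^sup>2)"
    using le_add_sum_increments[of "\<lambda>k. (norm (z k - p))\<^sup>2", OF step, of 0 "Suc k"]
    by (simp add: atLeast0LessThan)
  then show ?thesis
    unfolding lessThan_Suc_atMost sum_subtractf sum_distrib_left[symmetric]
    using zero_le_power2[of "norm (z (Suc k) - p)"] by linarith
qed

text \<open>By \<open>residual_step\<close> each \<open>\<parallel>e\<^sub>j\<parallel>\<^sup>2\<close> with \<open>j \<le> k\<close> is at least \<open>\<parallel>e\<^sub>k\<parallel>\<^sup>2\<close> minus \<open>2 D\<close> times the perturbations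
  collected between \<open>j\<close> and \<open>k\<close>; inserting this into \<open>energy_bound\<close> isolates \<open>\<parallel>e\<^sub>k\<parallel>\<^sup>2\<close>.  The
  constants \<open>W\<close>, \<open>M\<close>, \<open>D\<close>, \<open>t\<close> stand for the suprema in \<open>\<nu>\<^sub>1\<close> and \<open>\<nu>\<^sub>2\<close> and that of \<open>\<tau>\<^sub>k\<close>.\<close>

lemma residual_bound:
  assumes W: "\<And>k. norm (w k - p) \<le> W" and M: "\<And>k. lam k * pi_norm k \<le> M"
    and D: "\<And>k. norm (e k - e (Suc k)) \<le> D"
    and tau_le: "\<And>k. tau lam k \<le> t"
    and tau_ge: "\<And>k. t0 \<le> tau lam k"
    and sum_lam: "summable (\<lambda>k. lam k * pi_norm k)"
    and sum_wt: "summable (\<lambda>k. real (k + 1) * pi_norm k)"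
  shows "t0 * real (k + 1) * (norm (e k))\<^sup>2
    \<le> (norm (z 0 - p))\<^sup>2 + ((2 * W + M) * (\<Sum>j. lam j * pi_norm j)
        + 2 * D * t * (\<Sum>l. real (l + 1) * pi_norm l))"
proof -
  have W0: "0 \<le> W"
    using order_trans[OF norm_ge_zero W[of 0]] .
  have D0: "0 \<le> D"
    using order_trans[OF norm_ge_zero D[of 0]] .
  have M0: "0 \<le> M"
    using order_trans[OF _ M[of 0]] lam_pos[of 0] by simp
  have tau0: "0 \<le> tau lam j" for j
    using lam_pos[of j] lam_le_1[of j] by (simp add: tau_def)
  have t: "0 \<le> t"
    using order_trans[OF tau0 tau_le[of 0]] .
  have decr: "(norm (e k))\<^sup>2 \<le> (norm (e j))\<^sup>2 + 2 * D * (\<Sum>l = j..<k. pi_norm l)" if "j \<le> k" for j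
  proof -
    have "(norm (e (Suc k)))\<^sup>2 \<le> (norm (e k))\<^sup>2 + 2 * D * pi_norm k" for k
      using residual_step[of k] mult_right_mono[OF D[of k] norm_ge_zero[of "pert T S eps z k"]]
      by linarith
    from le_add_sum_increments[of "\<lambda>k. (norm (e k))\<^sup>2", OF this that] show ?thesis
      by (simp add: sum_distrib_left)
  qed
  \<comment> \<open>Exchanging the order of summation, each \<open>l\<close> is met by the \<open>l + 1\<close> indices \<open>j \<le> l\<close>.\<close>
  have count: "(\<Sum>j\<le>k. \<Sum>l = j..<k. pi_norm l) = (\<Sum>l<k. real (l + 1) * pi_norm l)"
    by (induction k) (simp_all add: sum.distrib algebra_simps)
  have "t0 * real (k + 1) * (norm (e k))\<^sup>2 = (\<Sum>j\<le>k. t0 * (norm (e k))\<^sup>2)"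
    by simp
  also have "\<dots> \<le> (\<Sum>j\<le>k. tau lam j * (norm (e j))\<^sup>2 + 2 * D * t * (\<Sum>l = j..<k. pi_norm l))"
  proof (rule sum_mono)
    fix j assume "j \<in> {..k}"
    then have "t0 * (norm (e k))\<^sup>2 \<le> tau lam j * ((norm (e j))\<^sup>2 + 2 * D * (\<Sum>l = j..<k. pi_norm l))"
      using decr[of j] tau_ge[of j] tau0[of j] by (intro mult_mono) auto
    also have "\<dots> = tau lam j * (norm (e j))\<^sup>2 + tau lam j * (2 * D * (\<Sum>l = j..<k. pi_norm l))"
      by (simp add: algebra_simps)
    also have "\<dots> \<le> tau lam j * (norm (e j))\<^sup>2 + t * (2 * D * (\<Sum>l = j..<k. pi_norm l))"
      using tau_le[of j] D0 by (intro add_left_mono mult_right_mono) (auto intro!: mult_nonneg_nonneg sum_nonneg)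
    finally show "t0 * (norm (e k))\<^sup>2
        \<le> tau lam j * (norm (e j))\<^sup>2 + 2 * D * t * (\<Sum>l = j..<k. pi_norm l)"
      by (simp add: algebra_simps)
  qed
  also have "\<dots> = (\<Sum>j\<le>k. tau lam j * (norm (e j))\<^sup>2)
      + 2 * D * t * (\<Sum>l<k. real (l + 1) * pi_norm l)"
    unfolding sum.distrib sum_distrib_left[symmetric] count ..
  also have "\<dots> \<le> ((norm (z 0 - p))\<^sup>2 + (2 * W + M) * (\<Sum>j\<le>k. lam j * pi_norm j))
      + 2 * D * t * (\<Sum>l. real (l + 1) * pi_norm l)"
    using energy_bound[OF W M, of k] D0 t sum_wt
    by (intro add_mono mult_left_mono sum_le_suminf) auto
  also have "\<dots> \<le> ((norm (z 0 - p))\<^sup>2 + (2 * W + M) * (\<Sum>j. lam j * pi_norm j))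
      + 2 * D * t * (\<Sum>l. real (l + 1) * pi_norm l)"
    using W0 M0 sum_lam less_imp_le[OF lam_pos]
    by (intro add_right_mono add_left_mono mult_left_mono sum_le_suminf) auto
  finally show ?thesis
    by simp
qed

end

section \<open>Convergence rates\<close>

text \<open>The iterates stay in a ball and the perturbations are summable, so the suprema in \<open>C1\<close> are finite and \<open>C1\<close> is the
  embedding of a real constant to which lemma \<open>residual_bound\<close> applies.\<close>

lemma (in perturbed_iteration) pointwise_rate:
  assumes p: "p = nearest_fix T (z 0)"
    and tau_pos: "0 < (INF k. tau lam k)"
    and summable_eps: "summable (\<lambda>k. real (k + 1) * norm (eps k))"
    and summable_gap: "\<And>rho. 0 \<le> rho \<Longrightarrow> summable (\<lambda>k. real (k + 1) * op_gap T S k rho)"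
  shows "C1 T S lam eps z < \<infinity>"
    and "norm (e k) \<le> sqrt (((norm (z 0 - p))\<^sup>2 + enn2real (C1 T S lam eps z))
      / ((INF k. tau lam k) * real (k + 1)))"
proof -
  have lam_le: "lam k \<le> real (k + 1)" for k
    using lam_le_1[of k] by simp
  note hyps = lam_le summable_eps summable_gap
  have sum_wt: "summable (\<lambda>k. real (k + 1) * pi_norm k)"
    by (rule summable_weight_pert[OF hyps])
  have sum_lam: "summable (\<lambda>k. lam k * pi_norm k)"
    by (rule summable_lam_pert[OF hyps])
  obtain R where R: "\<And>k. norm (z k - p) \<le> R"
    using z_bounded[OF hyps] by blast
  have e_le: "norm (e k) \<le> 2 * R" for k
    using R[of k] norm_T_diff_fixed[of "z k"] norm_triangle_ineq4[of "z k - p" "T (z k) - p"]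
    by (simp add: e_eq)
  have lam_pert_nonneg: "0 \<le> lam k * pi_norm k" for k
    using lam_pos[of k] by simp
  have tau_nonneg: "0 \<le> tau lam k" for k
    using lam_pos[of k] lam_le_1[of k] by (simp add: tau_def)
  have w_le: "norm (w k - p) \<le> R" for k
    using order_trans[OF w_dist R] .
  have pert_le: "lam k * pi_norm k \<le> (\<Sum>j. lam j * pi_norm j)" for k
    using sum_le_suminf[OF sum_lam, of "{k}"] lam_pert_nonneg by auto
  have de_le: "norm (e k - e (Suc k)) \<le> 4 * R" for k
    using e_le[of k] e_le[of "Suc k"] norm_triangle_ineq4[of "e k" "e (Suc k)"] by linarith
  have tau_le: "tau lam k \<le> 1" for k
    using lam_pos[of k] lam_le_1[of k] by (simp add: tau_def mult_le_one)
  note sup_w = ennreal_SUP_of_bounded[of "\<lambda>k. norm (w k - p)", OF norm_ge_zero w_le]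
  note sup_pert = ennreal_SUP_of_bounded[of "\<lambda>k. lam k * pi_norm k", OF lam_pert_nonneg pert_le]
  note sup_de = ennreal_SUP_of_bounded[of "\<lambda>k. norm (e k - e (Suc k))", OF norm_ge_zero de_le]
  note sup_tau = ennreal_SUP_of_bounded[of "tau lam", OF tau_nonneg tau_le]
  define W where "W = (SUP k. norm (w k - p))"
  define M where "M = (SUP k. lam k * pi_norm k)"
  define D where "D = (SUP k. norm (e k - e (Suc k)))"
  define t where "t = (SUP k. tau lam k)"
  define c where "c = (2 * W + M) * (\<Sum>j. lam j * pi_norm j)
    + 2 * D * t * (\<Sum>l. real (l + 1) * pi_norm l)"
  have nonneg: "0 \<le> W" "0 \<le> M" "0 \<le> D" "0 \<le> t"
    unfolding W_def M_def D_def t_def using sup_w(3) sup_pert(3) sup_de(3) sup_tau(3) by auto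
  have series_nonneg: "0 \<le> (\<Sum>j. lam j * pi_norm j)" "0 \<le> (\<Sum>l. real (l + 1) * pi_norm l)"
    using sum_lam sum_wt lam_pert_nonneg by (auto intro!: suminf_nonneg)
  have c_nonneg: "0 \<le> c"
    unfolding c_def using nonneg series_nonneg by (intro add_nonneg_nonneg mult_nonneg_nonneg) auto
  have two: "2 * ennreal x = ennreal (2 * x)" if "0 \<le> x" for x
    using that by (simp add: ennreal_mult)
  have nu1: "nu1 T S lam eps z = ennreal (2 * W + M)"
    unfolding nu1_def p[symmetric] w_def[symmetric] sup_w(1) sup_pert(1)
    using nonneg by (simp add: W_def[symmetric] M_def[symmetric] two ennreal_plus)
  have nu2: "nu2 T S lam eps z = ennreal (2 * D)"
    unfolding nu2_def sup_de(1) using nonneg by (simp add: D_def[symmetric] two)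
  have series: "(\<Sum>j. ennreal (lam j * pi_norm j)) = ennreal (\<Sum>j. lam j * pi_norm j)"
    "(\<Sum>l. ennreal (real (l + 1) * pi_norm l)) = ennreal (\<Sum>l. real (l + 1) * pi_norm l)"
    using sum_lam sum_wt lam_pert_nonneg by (auto intro!: suminf_ennreal2)
  have C1: "C1 T S lam eps z = ennreal c"
    unfolding C1_def nu1 nu2 sup_tau(1) series c_def t_def[symmetric]
    using nonneg series_nonneg by (simp add: ennreal_plus ennreal_mult)
  show "C1 T S lam eps z < \<infinity>"
    unfolding C1 by simp
  have tau_ge: "(INF k. tau lam k) \<le> tau lam k" for k
    using tau_nonneg by (intro cINF_lower bdd_belowI[of _ 0]) auto
  have "(INF k. tau lam k) * real (k + 1) * (norm (e k))\<^sup>2 \<le> (norm (z 0 - p))\<^sup>2 + c"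
    unfolding c_def
    by (rule residual_bound[OF _ _ _ _ tau_ge sum_lam sum_wt])
      (use sup_w(2) sup_pert(2) sup_de(2) sup_tau(2) in \<open>auto simp: W_def M_def D_def t_def\<close>)
  then have "(norm (e k))\<^sup>2 \<le> ((norm (z 0 - p))\<^sup>2 + c) / ((INF k. tau lam k) * real (k + 1))"
    using tau_pos by (simp add: pos_le_divide_eq mult_ac)
  then show "norm (e k) \<le> sqrt (((norm (z 0 - p))\<^sup>2 + enn2real (C1 T S lam eps z))
      / ((INF k. tau lam k) * real (k + 1)))"
    unfolding C1 using c_nonneg by (simp add: real_le_rsqrt)
qed

lemma (in perturbed_iteration) ergodic_rate:
  assumes summable_eps: "summable (\<lambda>k. lam k * norm (eps k))"
    and summable_gap: "\<And>rho. 0 \<le> rho \<Longrightarrow> summable (\<lambda>k. lam k * op_gap T S k rho)"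
  shows "C2 T S lam eps z < \<infinity>"
    and "norm (avg_resid T S lam eps z k)
      \<le> 2 * (norm (z 0 - p) + enn2real (C2 T S lam eps z)) / Lam lam k"
proof -
  have sum_lam: "summable (\<lambda>k. lam k * pi_norm k)"
    by (rule summable_lam_pert[OF order_refl summable_eps summable_gap])
  have nonneg: "0 \<le> lam k * pi_norm k" for k
    using lam_pos[of k] by simp
  have C2: "C2 T S lam eps z = ennreal (\<Sum>j. lam j * pi_norm j)"
    unfolding C2_def using nonneg sum_lam by (intro suminf_ennreal2) auto
  show "C2 T S lam eps z < \<infinity>"
    unfolding C2 by simp
  show "norm (avg_resid T S lam eps z k)
      \<le> 2 * (norm (z 0 - p) + enn2real (C2 T S lam eps z)) / Lam lam k"
    unfolding C2 using norm_avg_resid_le[OF sum_lam, of k] nonneg sum_lam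
    by (simp add: suminf_nonneg)
qed

lemma bigo_inverse_of_Lam_bound:
  fixes x lam :: "nat \<Rightarrow> real"
  assumes "\<And>k. 0 \<le> x k" "\<And>k. x k \<le> c / Lam lam k" "0 \<le> c"
    and "0 < l" "\<And>k. l \<le> lam k"
  shows "x \<in> O(\<lambda>k. 1 / real k)"
proof (rule bigoI[of _ "c / l"])
  have "norm (x k) \<le> c / l * norm (1 / real k)" if "1 \<le> k" for k
  proof -
    have "l * real k \<le> l * real (k + 1)"
      using assms(4) by simp
    also have "\<dots> = (\<Sum>j\<le>k. l)"
      by simp
    also have "\<dots> \<le> Lam lam k"
      unfolding Lam_def using assms(5) by (intro sum_mono) auto
    finally have "l * real k \<le> Lam lam k" .
    moreover have "0 < l * real k"
      using assms(4) that by simp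
    ultimately have "c / Lam lam k \<le> c / (l * real k)"
      using assms(3) by (intro divide_left_mono) (auto intro: mult_pos_pos less_le_trans)
    then show ?thesis
      using assms(1,2)[of k] by simp
  qed
  then show "eventually (\<lambda>k. norm (x k) \<le> c / l * norm (1 / real k)) sequentially"
    by (auto simp: eventually_sequentially)
qed

theorem proposition5:
  fixes T :: "'a::{real_inner, complete_space} \<Rightarrow> 'a"
    and S :: "nat \<Rightarrow> 'a \<Rightarrow> 'a"
    and lam :: "nat \<Rightarrow> real"
    and eps z :: "nat \<Rightarrow> 'a"
  assumes "nonexpansive T"
    and "\<And>k. nonexpansive (S k)"
    and "fix_set T \<noteq> {}"
    and "km_iteration S lam eps z"
  shows
    "((\<forall>k. 0 < lam k \<and> lam k < 1) \<and>
      0 < (INF k. tau lam k) \<and>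
      summable (\<lambda>k. real (k + 1) * norm (eps k)) \<and>
      (\<forall>rho\<ge>0. summable (\<lambda>k. real (k + 1) * op_gap T S k rho))
      \<longrightarrow>
      C1 T S lam eps z < \<infinity> \<and>
      (\<forall>k. norm (resid T S lam eps z k)
         \<le> sqrt (((init_dist T (z 0))\<^sup>2 + enn2real (C1 T S lam eps z))
                  / ((INF k. tau lam k) * real (k + 1)))))
     \<and>
     ((\<forall>k. 0 < lam k \<and> lam k \<le> 1) \<and>
      summable (\<lambda>k. lam k * norm (eps k)) \<and>
      (\<forall>rho\<ge>0. summable (\<lambda>k. lam k * op_gap T S k rho))
      \<longrightarrow>
      C2 T S lam eps z < \<infinity> \<and>
      (\<forall>k. norm (avg_resid T S lam eps z k)
         \<le> 2 * (init_dist T (z 0) + enn2real (C2 T S lam eps z)) / Lam lam k) \<and>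
      (0 < (INF k. lam k) \<longrightarrow>
         (\<lambda>k. norm (avg_resid T S lam eps z k)) \<in> O(\<lambda>k. 1 / real k)))"
proof (intro conjI impI; (elim conjE)?)
  let ?p = "nearest_fix T (z 0)"
  note p = nearest_fix_properties[OF assms(1,3), of "z 0"]
  {
    assume lam: "\<forall>k. 0 < lam k \<and> lam k < 1" and tau: "0 < (INF k. tau lam k)"
      and eps: "summable (\<lambda>k. real (k + 1) * norm (eps k))"
      and gap: "\<forall>rho\<ge>0. summable (\<lambda>k. real (k + 1) * op_gap T S k rho)"
    interpret perturbed_iteration T S lam eps z ?p
      by unfold_locales (use assms p lam in \<open>auto intro: less_imp_le\<close>)
    show "C1 T S lam eps z < \<infinity>"
      using pointwise_rate(1)[OF refl tau eps] gap by blast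
    show "\<forall>k. norm (resid T S lam eps z k)
         \<le> sqrt (((init_dist T (z 0))\<^sup>2 + enn2real (C1 T S lam eps z))
                  / ((INF k. tau lam k) * real (k + 1)))"
      using pointwise_rate(2)[OF refl tau eps] gap unfolding p(2) by blast
  }
  {
    assume lam: "\<forall>k. 0 < lam k \<and> lam k \<le> 1"
      and eps: "summable (\<lambda>k. lam k * norm (eps k))"
      and gap: "\<forall>rho\<ge>0. summable (\<lambda>k. lam k * op_gap T S k rho)"
    interpret perturbed_iteration T S lam eps z ?p
      by unfold_locales (use assms p lam in auto)
    show "C2 T S lam eps z < \<infinity>"
      using ergodic_rate(1)[OF eps] gap by blast
    have bound: "norm (avg_resid T S lam eps z k)
         \<le> 2 * (init_dist T (z 0) + enn2real (C2 T S lam eps z)) / Lam lam k" for k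
      using ergodic_rate(2)[OF eps] gap unfolding p(2) by blast
    then show "\<forall>k. norm (avg_resid T S lam eps z k)
         \<le> 2 * (init_dist T (z 0) + enn2real (C2 T S lam eps z)) / Lam lam k"
      by blast
    assume inf: "0 < (INF k. lam k)"
    have "(INF k. lam k) \<le> lam k" for k
      using lam by (intro cINF_lower bdd_belowI[of _ 0]) (auto intro: less_imp_le)
    moreover have "0 \<le> 2 * (init_dist T (z 0) + enn2real (C2 T S lam eps z))"
      unfolding p(2)[symmetric] by simp
    ultimately show "(\<lambda>k. norm (avg_resid T S lam eps z k)) \<in> O(\<lambda>k. 1 / real k)"
      using bigo_inverse_of_Lam_bound[OF norm_ge_zero bound _ inf] by blast
  }
qed

end
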